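(* For every positive integer $n\ge1$ and every positive integer $m$ which is either odd or equal to $2$, there exists an order $m$ Hadamard hypermatrix of side length $2^n$. In contrast, if $m$ is an even integer larger than $2$, then there is no order $m$ Hadamard hypermatrix of side length $2$.
   Context: All indices start at $0$. A cubic order $m$ hypermatrix of side length $N$ is an array $\mathbf{H}=(h_{i_1\cdots i_m})_{0\le i_1,\dots,i_m<N}$. Its transpose has entries $[\mathbf{H}^\top]_{i_1,\dots,i_m}=h_{i_m i_1\cdots i_{m-1}}$, and $\mathbf{H}^{\top^k}$ is the $k$-fold iterate. The Bhattacharya-Mesner product is $$[\mathrm{Prod}(\mathbf{A}^{(1)},\dots,\mathbf{A}^{(m)})]_{i_1,\dots,i_m}=\sum_{0\le j<N}a^{(1)}_{i_1\,j\,i_3\cdots i_m}\cdots a^{(s)}_{i_1\cdots i_s\,j\,i_{s+2}\cdots i_m}\cdots a^{(m)}_{j\,i_2\cdots i_m},$$ where the $s$-th factor has index $i_{s+1}$ replaced by $j$ for $s<m$ and the $m$-th factor has $i_1$ replaced by $j$. An order $m$ hypermatrix $\mathbf{H}\in\{-1,1\}^{N\times\cdots\times N}$ is Hadamard if $$\big[\mathrm{Prod}(\mathbf{H},\mathbf{H}^{\top^{(m-1)}},\dots,\mathbf{H}^{\top^2},\mathbf{H}^\top)\big]_{i_1,\dots,i_m}=\begin{cases}N&\text{if }i_1=\cdots=i_m\\0&\text{otherwise,}\end{cases}$$ where for $m\ge2$ the left-hand side is explicitly $\sum_{0\le t<N}h_{i_1\,t\,i_3\cdots i_m}\,h_{i_2\,t\,i_4\cdots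 i_mi_1}\cdots h_{i_m\,t\,i_2\cdots i_{m-1}}$ (for $m=2$: $\sum_t h_{i_1t}h_{i_2t}$, the usual Hadamard matrix condition). *)

theory Defs
  imports Main
begin

text \<open>
  A cubic hypermatrix of order \<open>m\<close> and side length \<open>N\<close> is a function on index lists; only its
  values on \<open>hm_indices m N\<close> are meaningful, and all notions below inspect only those values.
\<close>

type_synonym 'a hypermatrix = "nat list \<Rightarrow> 'a"

definition hm_indices :: "nat \<Rightarrow> nat \<Rightarrow> nat list set" where
  "hm_indices m N = {i. length i = m \<and> set i \<subseteq> {..<N}}"

definition hm_transpose :: "'a hypermatrix \<Rightarrow> 'a hypermatrix" where
  "hm_transpose H = (\<lambda>i. H (last i # butlast i))"

text \<open>
  Bhattacharya-Mesner product of a list of \<open>m\<close> hypermatrices of order \<open>m\<close>. Counting factors and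
  positions from 0, factor \<open>s\<close> has its index at position \<open>s + 1\<close> replaced by the summation index,
  except that the last factor has its index at position 0 replaced.
\<close>

definition bm_prod :: "nat \<Rightarrow> 'a::comm_semiring_1 hypermatrix list \<Rightarrow> 'a hypermatrix" where
  "bm_prod N As = (\<lambda>i. \<Sum>j<N. \<Prod>s<length As. (As ! s) (i[Suc s mod length As := j]))"

text \<open>
  For \<open>m \<ge> 1\<close> the list of factors is \<open>H\<close> followed by its iterated transposes with exponents
  \<open>m - 1, \<dots>, 2, 1\<close>; for \<open>m = 1\<close> it is just \<open>[H]\<close>.
\<close>

definition hadamard_hypermatrix :: "nat \<Rightarrow> nat \<Rightarrow> int hypermatrix \<Rightarrow> bool" where
  "hadamard_hypermatrix m N H \<longleftrightarrow>
     (\<forall>i \<in> hm_indices m N. H i \<in> {-1, 1}) \<and>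
     (\<forall>i \<in> hm_indices m N.
        bm_prod N (H # map (\<lambda>k. (hm_transpose ^^ k) H) (rev [1..<m])) i =
          (if \<forall>k<m. i ! k = i ! 0 then int N else 0))"

end

theory Submission
  imports Defs
begin

text \<open>
  Read an index list \<open>i\<close> of length \<open>m\<close> as a cyclic word. The factors of the product are then the
  values of \<open>H\<close> on the \<open>m\<close> rotations of the word, each with the letter at position 1 replaced by the
  summation index \<open>j\<close> (\<open>hadamard_hypermatrix_iff_rotate\<close>). Everything below is an argument about these
  rotations.

  Existence. In this form the condition is visibly multiplicative, so Kronecker products of Hadamard
  hypermatrices are Hadamard (\<open>hadamard_hypermatrix_kronecker\<close>), and it suffices to treat side
  length 2. Order 1 is the all-ones vector and order 2 is the Sylvester matrix. For odd \<open>m \<ge> 3\<close> let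
  \<open>H\<close> be 1 whenever the letter at position 1 is 0; then the summand for \<open>j = 0\<close> is always 1, and the
  summand for \<open>j = 1\<close> has to be 1 on constant words and \<open>-1\<close> on all others. If \<open>H\<close> were \<open>-1\<close> on
  every list with 1 at position 1, this second summand would be \<open>(-1) ^ m = -1\<close> for every word,
  which is wrong only on the two constant words. It therefore remains to correct the signs on a set of
  windows, that is, of words with one letter deleted, that is met an odd number of times by a constant
  word and an even number of times by any other. The sorted windows do this. All \<open>m\<close> windows of
  a constant word are sorted. In a nonconstant cyclic binary word no two descents are adjacent, so
  deleting one letter leaves a sorted window only if there is exactly one descent, and then exactly for
  the two letters that form it (\<open>even_card_sorted_windows\<close>).

  Nonexistence. If \<open>m\<close> is even and greater than 2, there is a nonconstant word of the form \<open>u @ u\<close>. Its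
  rotations come in equal pairs, so every summand is a product of squares of signs; the sum is the
  side length and not 0 (\<open>no_hadamard_hypermatrix_even_order\<close>).
\<close>

section \<open>The Hadamard condition in terms of rotated index lists\<close>

lemma hm_transpose_funpow:
  assumes "k \<le> length i"
  shows "(hm_transpose ^^ k) H i = H (rotate (length i - k) i)"
  using assms
proof (induction k arbitrary: i)
  case 0
  then show ?case by simp
next
  case (Suc k)
  then have ne: "i \<noteq> []" by auto
  let ?j = "last i # butlast i"
  have len: "length ?j = length i" using ne by simp
  have rot: "rotate1 ?j = i" using ne by simp
  have "(hm_transpose ^^ Suc k) H i = (hm_transpose ^^ k) H ?j"
    by (simp add: hm_transpose_def)
  also have "\<dots> = H (rotate (length i - k) ?j)"
    using Suc.IH[of ?j] Suc.prems len by simp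
  also have "length i - k = Suc (length i - Suc k)" using Suc.prems by simp
  also have "rotate (Suc (length i - Suc k)) ?j = rotate (length i - Suc k) i"
    by (metis rot rotate1_rotate_swap rotate_Suc)
  finally show ?case .
qed

text \<open>
  The Bhattacharya-Mesner product overwrites a different position in each factor; the rotations coming
  from the transposes bring all of these positions to position 1 (position 0 when the list is a
  singleton).
\<close>

lemma rotate_update_Suc:
  assumes "xs \<noteq> []"
  shows "rotate s (xs[Suc s mod length xs := x]) = (rotate s xs)[1 mod length xs := x]"
proof (rule nth_equalityI)
  show "length (rotate s (xs[Suc s mod length xs := x])) = length ((rotate s xs)[1 mod length xs := x])"
    by simp
next
  fix p assume "p < length (rotate s (xs[Suc s mod length xs := x]))"
  then have p: "p < length xs" by simp
  have "Suc s mod length xs = (s + p) mod length xs \<longleftrightarrow> 1 mod length xs = p"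
  proof -
    have "Suc s mod length xs = (s + p) mod length xs \<longleftrightarrow> 1 mod length xs = p mod length xs"
      unfolding nat_mod_eq_iff by simp
    then show ?thesis using p by simp
  qed
  then show "rotate s (xs[Suc s mod length xs := x]) ! p = (rotate s xs)[1 mod length xs := x] ! p"
    using p assms by (simp add: nth_rotate nth_list_update)
qed

lemma hadamard_hypermatrix_iff_rotate:
  assumes "m \<ge> 1"
  shows "hadamard_hypermatrix m N H \<longleftrightarrow>
     (\<forall>i \<in> hm_indices m N. H i \<in> {-1, 1}) \<and>
     (\<forall>i \<in> hm_indices m N.
        (\<Sum>j<N. \<Prod>s<m. H ((rotate s i)[1 mod m := j])) =
          (if \<forall>k<m. i ! k = i ! 0 then int N else 0))"
proof -
  let ?L = "H # map (\<lambda>k. (hm_transpose ^^ k) H) (rev [1..<m])"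
  have len: "length ?L = m" using assms by simp
  have "bm_prod N ?L i = (\<Sum>j<N. \<Prod>s<m. H ((rotate s i)[1 mod m := j]))"
    if "i \<in> hm_indices m N" for i
  proof -
    have li: "length i = m" using that by (simp add: hm_indices_def)
    then have ne: "i \<noteq> []" using assms by auto
    have "(?L ! s) (i[Suc s mod m := j]) = H ((rotate s i)[1 mod m := j])" if "s < m" for s j
    proof -
      have "(?L ! s) (i[Suc s mod m := j]) = H (rotate s (i[Suc s mod m := j]))"
      proof (cases s)
        case 0
        then show ?thesis by simp
      next
        case (Suc r)
        then have "r < m - 1" using that by simp
        then have "rev [1..<m] ! r = m - s"
          using Suc by (simp add: rev_nth Suc_diff_Suc)
        then have "?L ! s = (hm_transpose ^^ (m - s)) H"
          using Suc \<open>r < m - 1\<close> by simp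
        moreover have "m - (m - s) = s" using that by simp
        ultimately show ?thesis
          using hm_transpose_funpow[of "m - s" "i[Suc s mod m := j]" H] li by simp
      qed
      then show ?thesis using rotate_update_Suc[OF ne, of s j] li by simp
    qed
    then show ?thesis unfolding bm_prod_def len by (intro sum.cong prod.cong) auto
  qed
  then show ?thesis unfolding hadamard_hypermatrix_def by auto
qed

lemma rotate_update_in_hm_indices:
  assumes "i \<in> hm_indices m N" and "j < N"
  shows "(rotate s i)[p := j] \<in> hm_indices m N"
proof -
  have "set ((rotate s i)[p := j]) \<subseteq> insert j (set i)"
    using set_update_subset_insert[of "rotate s i" p j] by simp
  also have "\<dots> \<subseteq> {..<N}" using assms by (simp add: hm_indices_def)
  finally show ?thesis using assms(1) by (simp add: hm_indices_def)
qed

section \<open>Kronecker products\<close>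

lemma sum_mult_div_mod:
  fixes f g :: "nat \<Rightarrow> 'a::comm_semiring_1"
  shows "(\<Sum>j<N * M. f (j div M) * g (j mod M)) = (\<Sum>a<N. f a) * (\<Sum>b<M. g b)"
proof -
  have "(\<Sum>j<N * M. f (j div M) * g (j mod M)) =
        (\<Sum>a<N. \<Sum>j\<in>{a * M..<a * M + M}. f (j div M) * g (j mod M))"
    by (rule sum.nat_group[symmetric])
  also have "\<dots> = (\<Sum>a<N. \<Sum>b<M. f a * g b)"
  proof (rule sum.cong[OF refl])
    fix a
    have "(\<Sum>j\<in>{a * M..<a * M + M}. f (j div M) * g (j mod M)) =
          (\<Sum>b\<in>{0..<M}. f ((b + a * M) div M) * g ((b + a * M) mod M))"
      using sum.shift_bounds_nat_ivl[of "\<lambda>j. f (j div M) * g (j mod M)" 0 "a * M" M]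
      by (simp add: add.commute)
    also have "\<dots> = (\<Sum>b<M. f a * g b)"
      by (intro sum.cong) auto
    finally show "(\<Sum>j\<in>{a * M..<a * M + M}. f (j div M) * g (j mod M)) = (\<Sum>b<M. f a * g b)" .
  qed
  also have "\<dots> = (\<Sum>a<N. f a) * (\<Sum>b<M. g b)"
    by (simp add: sum_product)
  finally show ?thesis .
qed

text \<open>
  A number below \<open>N * M\<close> is the pair of its quotient and remainder modulo \<open>M\<close>. Reading letters as
  pairs commutes with rotating and with overwriting, so the sum over \<open>j\<close> factors as in
  \<open>sum_mult_div_mod\<close>; and a word of pairs is constant iff both of its component words are.
\<close>

lemma hadamard_hypermatrix_kronecker:
  assumes m: "m \<ge> 1"
    and H: "hadamard_hypermatrix m N H" and K: "hadamard_hypermatrix m M K"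
  shows "hadamard_hypermatrix m (N * M)
           (\<lambda>i. H (map (\<lambda>x. x div M) i) * K (map (\<lambda>x. x mod M) i))"
    (is "hadamard_hypermatrix m _ ?HK")
proof -
  note H = H[unfolded hadamard_hypermatrix_iff_rotate[OF m]]
  note K = K[unfolded hadamard_hypermatrix_iff_rotate[OF m]]
  let ?d = "map (\<lambda>x. x div M)" and ?r = "map (\<lambda>x. x mod M)"
  have dr: "?d i \<in> hm_indices m N \<and> ?r i \<in> hm_indices m M" if "i \<in> hm_indices m (N * M)" for i
  proof -
    have "x div M < N \<and> x mod M < M" if "x \<in> set i" for x
    proof -
      have x: "x < N * M" using that \<open>i \<in> hm_indices m (N * M)\<close> by (auto simp: hm_indices_def)
      then have "M > 0" by (cases M) auto
      then show ?thesis using x by (simp add: less_mult_imp_div_less)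
    qed
    then show ?thesis using that by (auto simp: hm_indices_def)
  qed
  have "(\<Sum>j<N * M. \<Prod>s<m. ?HK ((rotate s i)[1 mod m := j])) =
          (if \<forall>k<m. i ! k = i ! 0 then int (N * M) else 0)" if i: "i \<in> hm_indices m (N * M)" for i
  proof -
    have li: "length i = m" using i by (simp add: hm_indices_def)
    have ifm: "(if a then int N else 0) * (if b then int M else 0) =
        (if a \<and> b then int (N * M) else 0)" for a b
      by simp
    define P where "P j = (\<Prod>s<m. H ((rotate s (?d i))[1 mod m := j]))" for j
    define Q where "Q j = (\<Prod>s<m. K ((rotate s (?r i))[1 mod m := j]))" for j
    have "(\<Prod>s<m. ?HK ((rotate s i)[1 mod m := j])) = P (j div M) * Q (j mod M)" for j
      unfolding P_def Q_def by (simp add: map_update rotate_map prod.distrib)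
    then have "(\<Sum>j<N * M. \<Prod>s<m. ?HK ((rotate s i)[1 mod m := j])) = sum P {..<N} * sum Q {..<M}"
      by (simp add: sum_mult_div_mod)
    also have "sum P {..<N} = (if \<forall>k<m. ?d i ! k = ?d i ! 0 then int N else 0)"
      unfolding P_def using H dr[OF i] by blast
    also have "sum Q {..<M} = (if \<forall>k<m. ?r i ! k = ?r i ! 0 then int M else 0)"
      unfolding Q_def using K dr[OF i] by blast
    also have "(if \<forall>k<m. ?d i ! k = ?d i ! 0 then int N else 0) *
        (if \<forall>k<m. ?r i ! k = ?r i ! 0 then int M else 0) =
        (if (\<forall>k<m. ?d i ! k = ?d i ! 0) \<and> (\<forall>k<m. ?r i ! k = ?r i ! 0) then int (N * M) else 0)"
      by (rule ifm)
    also have "(\<forall>k<m. ?d i ! k = ?d i ! 0) \<and> (\<forall>k<m. ?r i ! k = ?r i ! 0) \<longleftrightarrow>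
        (\<forall>k<m. i ! k = i ! 0)"
    proof
      assume "(\<forall>k<m. ?d i ! k = ?d i ! 0) \<and> (\<forall>k<m. ?r i ! k = ?r i ! 0)"
      then have "i ! k div M = i ! 0 div M" "i ! k mod M = i ! 0 mod M" if "k < m" for k
        using that m li by (metis length_map less_le_trans nth_map less_one)+
      then show "\<forall>k<m. i ! k = i ! 0" by (metis div_mult_mod_eq)
    next
      assume "\<forall>k<m. i ! k = i ! 0"
      then show "(\<forall>k<m. ?d i ! k = ?d i ! 0) \<and> (\<forall>k<m. ?r i ! k = ?r i ! 0)"
        using m li by (metis length_map less_le_trans nth_map less_one)
    qed
    finally show ?thesis .
  qed
  moreover have "?HK i \<in> {-1, 1}" if "i \<in> hm_indices m (N * M)" for i
  proof -
    have "H (?d i) \<in> {-1, 1}" "K (?r i) \<in> {-1, 1}" using H K dr[OF that] by auto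
    then show ?thesis by auto
  qed
  ultimately show ?thesis unfolding hadamard_hypermatrix_iff_rotate[OF m] by blast
qed

lemma hadamard_hypermatrix_all_ones:
  assumes m: "m \<ge> 1" and const: "\<And>i. i \<in> hm_indices m N \<Longrightarrow> \<forall>k<m. i ! k = i ! 0"
  shows "hadamard_hypermatrix m N (\<lambda>i. 1)"
  unfolding hadamard_hypermatrix_iff_rotate[OF m]
proof (intro conjI ballI)
  fix i assume i: "i \<in> hm_indices m N"
  have "(\<forall>k<m. i ! k = i ! 0) = True" by (rule eqTrueI) (rule const[OF i])
  then show "(\<Sum>j<N. \<Prod>s<m. 1) = (if \<forall>k<m. i ! k = i ! 0 then int N else 0)"
    by (simp only: if_True) simp
qed simp

lemma hadamard_hypermatrix_side_one:
  assumes m: "m \<ge> 1"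
  shows "hadamard_hypermatrix m 1 (\<lambda>i. 1)"
proof (rule hadamard_hypermatrix_all_ones[OF m], intro allI impI)
  fix i k assume i: "i \<in> hm_indices m 1" and k: "k < m"
  then have "i ! k \<in> set i" "i ! 0 \<in> set i" "set i \<subseteq> {..<1}"
    by (auto simp: hm_indices_def)
  then have "i ! k < 1" "i ! 0 < 1" by blast+
  then show "i ! k = i ! 0" by simp
qed

lemma hadamard_hypermatrix_power:
  assumes m: "m \<ge> 1" and H: "hadamard_hypermatrix m N H"
  shows "\<exists>K. hadamard_hypermatrix m (N ^ n) K"
proof (induction n)
  case 0
  show ?case using hadamard_hypermatrix_side_one[OF m] by auto
next
  case (Suc n)
  then obtain K where "hadamard_hypermatrix m (N ^ n) K" by blast
  from hadamard_hypermatrix_kronecker[OF m H this] show ?case by (auto simp only: power_Suc)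
qed

section \<open>Side length two\<close>

lemma hadamard_hypermatrix_order_one: "hadamard_hypermatrix 1 N (\<lambda>i. 1)"
  by (rule hadamard_hypermatrix_all_ones) simp_all

lemma hadamard_hypermatrix_order_two:
  "hadamard_hypermatrix 2 2 (\<lambda>i. if i = [1, 1] then -1 else 1)"
proof -
  let ?H = "\<lambda>i :: nat list. if i = [1, 1] then -1 else (1 :: int)"
  have "(\<Sum>j<2. \<Prod>s<2. ?H ((rotate s i)[1 mod 2 := j])) =
          (if \<forall>k<2. i ! k = i ! 0 then int 2 else 0)" if hi: "i \<in> hm_indices 2 2" for i
  proof -
    obtain a b where i: "i = [a, b]" and "a < 2" "b < 2"
      using hi by (auto simp: hm_indices_def length_Suc_conv eval_nat_numeral)
    then have "a = 0 \<or> a = 1" "b = 0 \<or> b = 1" by linarith+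
    with i show ?thesis
      by (auto simp: numeral_2_eq_2 lessThan_Suc less_Suc_eq)
  qed
  then show ?thesis by (simp only: hadamard_hypermatrix_iff_rotate[of 2 2]) simp
qed

text \<open>
  The set on the right consists of the cyclic descents of the word \<open>i\<close>. The list on the left is the
  word with the letter at position \<open>Suc s mod m\<close> deleted, read from the following letter on. Its
  adjacent pairs are all cyclically adjacent pairs of \<open>i\<close> except the two that contain the deleted letter,
  which start at \<open>s\<close> and \<open>Suc s mod m\<close>.
\<close>

lemma sorted_tl_rotate_Suc_iff:
  fixes i :: "'a::linorder list"
  assumes m: "length i = m" and s: "s < m"
  shows "sorted (tl (rotate (Suc s) i)) \<longleftrightarrow>
     {q. q < m \<and> i ! (Suc q mod m) < i ! q} \<subseteq> {s, Suc s mod m}"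
proof
  assume srt: "sorted (tl (rotate (Suc s) i))"
  show "{q. q < m \<and> i ! (Suc q mod m) < i ! q} \<subseteq> {s, Suc s mod m}"
  proof (rule subsetI, rule ccontr)
    fix q assume q: "q \<in> {q. q < m \<and> i ! (Suc q mod m) < i ! q}" and nq: "q \<notin> {s, Suc s mod m}"
    \<comment> \<open>The position of letter \<open>q\<close> in the shortened list, which starts with letter \<open>s + 2\<close>.\<close>
    define k where "k = (if s < q then q - s - 2 else q + m - s - 2)"
    have k: "Suc (Suc s + k) = q \<or> Suc (Suc s + k) = q + m" "Suc k < m - 1"
      using q nq s by (auto simp: k_def mod_Suc split: if_splits)
    have "(Suc (Suc s + k)) mod m = q" "Suc (Suc (Suc s + k)) mod m = Suc q mod m"
      using k(1) q by (metis mem_Collect_eq mod_add_self2 mod_less mod_Suc_eq)+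
    moreover have "tl (rotate (Suc s) i) ! k \<le> tl (rotate (Suc s) i) ! Suc k"
      using srt k(2) m by (simp add: sorted_iff_nth_Suc del: rotate_Suc)
    ultimately have "i ! q \<le> i ! (Suc q mod m)"
      using k(2) m by (simp add: nth_tl nth_rotate del: rotate_Suc)
    then show False using q by auto
  qed
next
  assume sub: "{q. q < m \<and> i ! (Suc q mod m) < i ! q} \<subseteq> {s, Suc s mod m}"
  show "sorted (tl (rotate (Suc s) i))"
    unfolding sorted_iff_nth_Suc
  proof (intro allI impI)
    fix k assume "Suc k < length (tl (rotate (Suc s) i))"
    then have k: "Suc k < m - 1" using m by simp
    let ?q = "Suc (Suc s + k) mod m"
    have "?q \<noteq> s" "?q \<noteq> Suc s mod m" "?q < m"
      using k s by (auto simp: mod_if split: if_splits)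
    then have "?q \<notin> {q. q < m \<and> i ! (Suc q mod m) < i ! q}" using sub by blast
    then have "i ! ?q \<le> i ! (Suc ?q mod m)" using \<open>?q < m\<close> by (simp add: not_less)
    then show "tl (rotate (Suc s) i) ! k \<le> tl (rotate (Suc s) i) ! Suc k"
      using k m by (simp add: nth_tl nth_rotate mod_Suc_eq del: rotate_Suc)
  qed
qed

text \<open>
  The number is 0 or 2. By \<open>sorted_tl_rotate_Suc_iff\<close>, a window is sorted iff every descent starts at
  the deleted letter or just before it. Since a binary word has no two adjacent descents, this
  is impossible for two or more descents, and for a single descent there are two letters to delete.
\<close>

lemma even_card_sorted_windows:
  assumes i: "i \<in> hm_indices m 2" and nc: "\<not> (\<forall>k<m. i ! k = i ! 0)"
  shows "even (card {s. s < m \<and> sorted (tl (rotate (Suc s) i))})"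
proof -
  have m: "length i = m" using i by (simp add: hm_indices_def)
  have bin: "i ! q < 2" if "q < m" for q
  proof -
    have "i ! q \<in> set i" using that m by simp
    then show ?thesis using i by (auto simp: hm_indices_def)
  qed
  have m2: "m \<ge> 2" using nc by (metis not_less less_one less_trans_Suc not_less_eq numeral_2_eq_2 One_nat_def)
  define D where "D = {q. q < m \<and> i ! (Suc q mod m) < i ! q}"
  have A: "{s. s < m \<and> sorted (tl (rotate (Suc s) i))} = {s. s < m \<and> D \<subseteq> {s, Suc s mod m}}"
    unfolding D_def using sorted_tl_rotate_Suc_iff[OF m] by blast
  \<comment> \<open>A descent goes from 1 to 0, so the next step cannot descend again.\<close>
  have isol: "Suc q mod m \<notin> D" if "q \<in> D" for q
    using that bin[of q] m2 by (auto simp: D_def)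
  \<comment> \<open>Without descents the word would rise weakly all the way round, hence be constant.\<close>
  have "D \<noteq> {}"
  proof
    assume "D = {}"
    then have le: "i ! q \<le> i ! (Suc q mod m)" if "q < m" for q
      using that unfolding D_def by (metis (mono_tags, lifting) empty_Collect_eq not_less)
    have "sorted i"
      unfolding sorted_iff_nth_Suc using le m by (metis Suc_lessD mod_less)
    moreover have "i ! (m - 1) \<le> i ! 0" using le[of "m - 1"] m2 by simp
    ultimately have "i ! k = i ! 0" if "k < m" for k
      using that m sorted_nth_mono[of i 0 k] sorted_nth_mono[of i k "m - 1"] by fastforce
    then show False using nc by blast
  qed
  then obtain q where q: "q \<in> D" by blast
  then have qm: "q < m" by (simp add: D_def)
  show ?thesis
  proof (cases "D = {q}")
    case True
    \<comment> \<open>The cyclic predecessor of \<open>q\<close>: the two choices delete letter \<open>q\<close> (for \<open>s = p\<close>) or its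
      successor (for \<open>s = q\<close>).\<close>
    define p where "p = (if q = 0 then m - 1 else q - 1)"
    have "{s. s < m \<and> D \<subseteq> {s, Suc s mod m}} = {q, p}"
      unfolding True using qm m2 by (auto simp: p_def mod_Suc split: if_splits)
    moreover have "q \<noteq> p" using m2 by (auto simp: p_def)
    ultimately have "card {s. s < m \<and> D \<subseteq> {s, Suc s mod m}} = 2" by simp
    then show ?thesis unfolding A by simp
  next
    case False
    then obtain r where "r \<in> D" "r \<noteq> q" using q by blast
    then have "{s. s < m \<and> D \<subseteq> {s, Suc s mod m}} = {}"
      using isol q by blast
    then have "card {s. s < m \<and> D \<subseteq> {s, Suc s mod m}} = 0" by (simp only: card.empty)
    then show ?thesis unfolding A by (simp only: even_zero)
  qed
qed

text \<open>
  The list \<open>tl (rotate1 l)\<close> is \<open>l\<close> without its letter at position 1, read cyclically from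
  position 2 on. Hence overwriting position 1 does not affect it, and evaluating at the rotations
  of a word tests all windows of that word.
\<close>

lemma hadamard_hypermatrix_odd_order:
  assumes odd: "odd m" and m3: "m \<ge> 3"
  shows "hadamard_hypermatrix m 2 (\<lambda>l. if l ! 1 = 0 \<or> sorted (tl (rotate1 l)) then 1 else -1)"
    (is "hadamard_hypermatrix m 2 ?H")
proof -
  have "(\<Sum>j<2. \<Prod>s<m. ?H ((rotate s i)[1 mod m := j])) =
          (if \<forall>k<m. i ! k = i ! 0 then int 2 else 0)" if i: "i \<in> hm_indices m 2" for i
  proof -
    have li: "length i = m" using i by (simp add: hm_indices_def)
    define A where "A = {s. s < m \<and> sorted (tl (rotate (Suc s) i))}"
    have val: "?H ((rotate s i)[1 mod m := j]) =
        (if j = 0 \<or> sorted (tl (rotate (Suc s) i)) then 1 else -1)" for s j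
    proof -
      have "length (rotate s i) \<ge> 2" using li m3 by simp
      then obtain x y zs where r: "rotate s i = x # y # zs"
        by (metis One_nat_def Suc_1 Suc_le_length_iff)
      then show ?thesis using m3 by simp
    qed
    have zero: "(\<Prod>s<m. ?H ((rotate s i)[1 mod m := 0])) = 1"
      unfolding val by simp
    have "(\<Prod>s<m. ?H ((rotate s i)[1 mod m := 1])) = (\<Prod>s<m. if s \<in> A then 1 else -1)"
      unfolding val A_def by (intro prod.cong) auto
    also have "\<dots> = (-1) ^ card ({..<m} - A)"
      by (simp add: prod.If_cases Diff_eq)
    also have "card ({..<m} - A) = m - card A"
      by (subst card_Diff_subset) (auto simp: A_def)
    finally have one: "(\<Prod>s<m. ?H ((rotate s i)[1 mod m := 1])) = (-1) ^ (m - card A)" .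
    have "card A \<le> m" using card_mono[of "{..<m}" A] by (auto simp: A_def)
    define const where "const \<longleftrightarrow> (\<forall>k<m. i ! k = i ! 0)"
    have "(-1) ^ (m - card A) = (if const then 1 else (-1 :: int))"
    proof (cases const)
      case True
      then have "{q. q < m \<and> i ! (Suc q mod m) < i ! q} = {}"
        unfolding const_def by (metis (no_types, lifting) Collect_empty_eq less_irrefl mod_less_divisor gr_zeroI not_less0)
      then have "A = {..<m}"
        unfolding A_def using sorted_tl_rotate_Suc_iff[OF li] by auto
      then show ?thesis using True by simp
    next
      case False
      then have "even (card A)" unfolding A_def const_def using even_card_sorted_windows[OF i] by blast
      then show ?thesis using False odd \<open>card A \<le> m\<close> by simp
    qed
    then show ?thesis unfolding const_def[symmetric]
      using zero one by (simp add: lessThan_nat_numeral del: One_nat_def)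
  qed
  moreover have "m \<ge> 1" using m3 by simp
  ultimately show ?thesis by (simp only: hadamard_hypermatrix_iff_rotate) simp
qed

section \<open>Even orders greater than two\<close>

text \<open>
  The factors for \<open>s\<close> and \<open>s + k\<close> agree on a word of period \<open>k = m div 2\<close>. A nonconstant word of
  this period exists because \<open>k \<ge> 2\<close> and there are at least two letters; for \<open>m = 2\<close> the period would
  be 1.
\<close>

lemma no_hadamard_hypermatrix_even_order:
  assumes "even m" and "m > 2" and N: "N \<ge> 2"
  shows "\<not> hadamard_hypermatrix m N H"
proof
  assume "hadamard_hypermatrix m N H"
  moreover have m1: "m \<ge> 1" using assms by simp
  ultimately have ent: "\<And>i. i \<in> hm_indices m N \<Longrightarrow> H i \<in> {-1, 1}"
    and had: "\<And>i. i \<in> hm_indices m N \<Longrightarrow> (\<Sum>j<N. \<Prod>s<m. H ((rotate s i)[1 mod m := j])) =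
          (if \<forall>k<m. i ! k = i ! 0 then int N else 0)"
    by (auto simp: hadamard_hypermatrix_iff_rotate)
  obtain k where mk: "m = k + k" using \<open>even m\<close> by (metis evenE mult_2)
  have k2: "k \<ge> 2" using assms mk by simp
  define u :: "nat list" where "u = 0 # replicate (k - 1) 1"
  have lu: "length u = k" using k2 by (simp add: u_def)
  have i: "u @ u \<in> hm_indices m N" using N lu mk by (auto simp: hm_indices_def u_def)
  have per: "rotate (s + k) (u @ u) = rotate s (u @ u)" for s
    using rotate_append[of u u] lu by (simp add: rotate_rotate[symmetric])
  have "(\<Prod>s<m. H ((rotate s (u @ u))[1 mod m := j])) = 1" if "j < N" for j
  proof -
    define F where "F s = H ((rotate s (u @ u))[1 mod m := j])" for s
    have sq: "F s * F s = 1" for s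
      using ent[OF rotate_update_in_hm_indices[OF i that, of s "1 mod m"]] unfolding F_def by auto
    have "(\<Prod>s<m. F s) = (\<Prod>s<k. F s) * (\<Prod>s<k. F (s + k))"
      unfolding mk using prod.atLeastLessThan_concat[of 0 k "k + k" F]
        prod.shift_bounds_nat_ivl[of F 0 k k]
      by (simp add: atLeast0LessThan)
    also have "\<dots> = (\<Prod>s<k. F s * F s)"
      by (simp add: F_def per prod.distrib)
    finally show ?thesis unfolding sq by (simp add: F_def)
  qed
  then have "(\<Sum>j<N. \<Prod>s<m. H ((rotate s (u @ u))[1 mod m := j])) = int N" by simp
  moreover have "(u @ u) ! 1 \<noteq> (u @ u) ! 0" using k2 by (simp add: u_def nth_append)
  moreover have "1 < m" using assms by simp
  ultimately show False using had[OF i] N by (metis of_nat_eq_0_iff not_numeral_le_zero)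
qed

theorem theorem5:
  "(\<forall>n m :: nat. n \<ge> 1 \<longrightarrow> m \<ge> 1 \<longrightarrow> odd m \<or> m = 2 \<longrightarrow>
      (\<exists>H. hadamard_hypermatrix m (2 ^ n) H)) \<and>
   (\<forall>m :: nat. even m \<longrightarrow> m > 2 \<longrightarrow> \<not> (\<exists>H. hadamard_hypermatrix m 2 H))"
proof (intro conjI allI impI)
  fix n m :: nat
  assume "m \<ge> 1" and "odd m \<or> m = 2"
  then consider "m = 1" | "m = 2" | "odd m" "m \<ge> 3" 
  proof -
    have "m = 1 \<or> m = 2 \<or> m \<ge> 3" using \<open>m \<ge> 1\<close> by linarith
    then show thesis using that \<open>odd m \<or> m = 2\<close> by auto
  qed
  then have "\<exists>H. hadamard_hypermatrix m 2 H"
    by cases (use hadamard_hypermatrix_order_one hadamard_hypermatrix_order_two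
        hadamard_hypermatrix_odd_order in blast)+
  then show "\<exists>H. hadamard_hypermatrix m (2 ^ n) H"
    using hadamard_hypermatrix_power[OF \<open>m \<ge> 1\<close>] by blast
next
  fix m :: nat
  assume "even m" "m > 2"
  then show "\<not> (\<exists>H. hadamard_hypermatrix m 2 H)"
    using no_hadamard_hypermatrix_even_order by blast
qed

end
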